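(* Let $G$ be the chain graph with vertex set $\{1,2,3,4\}$ and edges $1\to 3$, $2-3$, $3-4$. If all four variables are binary ($d_1=d_2=d_3=d_4=2$), then a positive probability vector $p=(p_{ijk\ell})_{i,j,k,\ell\in\{1,2\}}$ is in $\mathbf{P}_{\mathrm{III}}(G)$ if and only if at least one of the following two conditions is met: (i) $1\perp\!\!\!\perp\{2,3,4\}$ and $2\perp\!\!\!\perp\{1,4\}$, or (ii) $2\perp\!\!\!\perp4\mid1$ and $1\perp\!\!\!\perp\{2,4\}\mid3$ and $$p_{1121}p_{2222}-p_{1122}p_{2221}=p_{1111}p_{2212}-p_{1112}p_{2211},$$ $$p_{1221}p_{2122}-p_{1222}p_{2121}=p_{1211}p_{2112}-p_{1212}p_{2111}.$$
   Context: $X=(X_1,X_2,X_3,X_4)$ is a random vector with $X_v$ taking values in $\{1,2\}$, and $p_{ijk\ell}=P(X_1=i,X_2=j,X_3=k,X_4=\ell)$; "positive" means all $p_{ijk\ell}>0$ (and they sum to one). $\alpha\perp\!\!\!\perp\beta\mid\gamma$ denotes that $X_\alpha$ and $X_\beta$ are conditionally independent given $X_\gamma$ under $p$, and $\alpha\perp\!\!\!\perp\beta$ marginal independence. $\mathbf{P}_{\mathrm{III}}(G)$ is the set of positive probability vectors obeying the block-recursive Markov property of type III of $G$ (chain components $\{1\}$ and $\{2,3,4\}$); for this graph it is the set of positive $p$ for which $2\perp\!\!\!\perp4\mid1$ and $1\perp\!\!\!\perp\{2,4\}\mid3$. *)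

theory Defs
  imports "HOL-Probability.Probability"
begin

section \<open>Chain graphs\<close>

text \<open>
  A mixed graph has directed edges (\<open>u \<rightarrow> v\<close> is \<open>(u, v) \<in> arrows G\<close>) and undirected edges
  (\<open>u - v\<close> is represented by both \<open>(u, v)\<close> and \<open>(v, u)\<close> in \<open>lines G\<close>).
\<close>

record 'v mixed_graph =
  verts :: "'v set"
  arrows :: "('v \<times> 'v) set"
  lines :: "('v \<times> 'v) set"

text \<open>
  The last condition excludes semi-directed cycles, i.e. cycles that traverse lines in either
  direction and arrows only forwards, with at least one arrow. It implies that no two vertices
  are joined by more than one edge.
\<close>

definition chain_graph :: "'v mixed_graph \<Rightarrow> bool" where
  "chain_graph G \<longleftrightarrow> finite (verts G)
     \<and> arrows G \<subseteq> verts G \<times> verts G \<and> lines G \<subseteq> verts G \<times> verts G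
     \<and> sym (lines G) \<and> irrefl (lines G)
     \<and> (\<forall>(u, v) \<in> arrows G. (v, u) \<notin> (arrows G \<union> lines G)\<^sup>*)"

definition chain_components :: "'v mixed_graph \<Rightarrow> 'v set set" where
  "chain_components G = (\<lambda>v. (lines G)\<^sup>* `` {v}) ` verts G"

text \<open>Parents and undirected neighbours of a set \<open>\<sigma>\<close> of vertices of one chain component.\<close>

definition pa :: "'v mixed_graph \<Rightarrow> 'v set \<Rightarrow> 'v set" where
  "pa G \<sigma> = {u. \<exists>v\<in>\<sigma>. (u, v) \<in> arrows G}"

definition nb :: "'v mixed_graph \<Rightarrow> 'v set \<Rightarrow> 'v set" where
  "nb G \<sigma> = {u. \<exists>v\<in>\<sigma>. (u, v) \<in> lines G} - \<sigma>"

definition Cl :: "'v mixed_graph \<Rightarrow> 'v set \<Rightarrow> 'v set" where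
  "Cl G \<sigma> = \<sigma> \<union> nb G \<sigma>"

text \<open>
  The directed acyclic graph \<open>D\<close> of chain components. Parents \<open>pa_D\<close> and non-descendants \<open>nd_D\<close>
  of a component are returned as sets of vertices of \<open>G\<close>, i.e. as the union of the components
  concerned. A component is neither a parent nor a non-descendant of itself.
\<close>

definition comp_dag :: "'v mixed_graph \<Rightarrow> ('v set \<times> 'v set) set" where
  "comp_dag G = {(\<tau>, \<tau>'). \<tau> \<in> chain_components G \<and> \<tau>' \<in> chain_components G
     \<and> (\<exists>u\<in>\<tau>. \<exists>v\<in>\<tau>'. (u, v) \<in> arrows G)}"

definition pa_D :: "'v mixed_graph \<Rightarrow> 'v set \<Rightarrow> 'v set" where
  "pa_D G \<tau> = \<Union>{\<tau>'. (\<tau>', \<tau>) \<in> comp_dag G}"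

definition nd_D :: "'v mixed_graph \<Rightarrow> 'v set \<Rightarrow> 'v set" where
  "nd_D G \<tau> = \<Union>{\<tau>' \<in> chain_components G. (\<tau>, \<tau>') \<notin> (comp_dag G)\<^sup>*}"


section \<open>Conditional independence\<close>

text \<open>
  A joint distribution of discrete variables \<open>X\<^sub>v\<close> is a \<open>pmf\<close> on assignments \<open>x\<close>, with \<open>X\<^sub>v\<close> the
  coordinate map \<open>\<lambda>x. x v\<close> and \<open>X\<^sub>\<alpha>\<close> the map \<open>\<lambda>x. restrict x \<alpha>\<close>. When \<open>X\<^sub>\<gamma> = c\<close> has probability
  zero, both sides of the defining equation are zero.
\<close>

definition cond_indep :: "('v \<Rightarrow> 'a) pmf \<Rightarrow> 'v set \<Rightarrow> 'v set \<Rightarrow> 'v set \<Rightarrow> bool" where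
  "cond_indep p \<alpha> \<beta> \<gamma> \<longleftrightarrow> (\<forall>a b c.
     \<P>(x in p. restrict x \<alpha> = a \<and> restrict x \<beta> = b \<bar> restrict x \<gamma> = c)
     = \<P>(x in p. restrict x \<alpha> = a \<bar> restrict x \<gamma> = c)
       * \<P>(x in p. restrict x \<beta> = b \<bar> restrict x \<gamma> = c))"

definition marg_indep :: "('v \<Rightarrow> 'a) pmf \<Rightarrow> 'v set \<Rightarrow> 'v set \<Rightarrow> bool" where
  "marg_indep p \<alpha> \<beta> \<longleftrightarrow>
     prob_space.indep_var p (count_space UNIV) (\<lambda>x. restrict x \<alpha>)
                            (count_space UNIV) (\<lambda>x. restrict x \<beta>)"


section \<open>The model of type III\<close>

text \<open>
  The block-recursive Markov property of type III combines the Markov property of \<open>D\<close>, the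
  within-component independences given \<open>pa_D\<close> only (no conditioning on neighbours,
  in contrast to types I and II), and the independences from non-parents given parents and
  neighbours (in contrast to types II and IV, which omit the neighbours).
\<close>

definition block_recursive_III :: "'v mixed_graph \<Rightarrow> ('v \<Rightarrow> 'a) pmf \<Rightarrow> bool" where
  "block_recursive_III G p \<longleftrightarrow> (\<forall>\<tau> \<in> chain_components G.
     cond_indep p \<tau> (nd_D G \<tau> - pa_D G \<tau>) (pa_D G \<tau>)
     \<and> (\<forall>\<sigma>. \<sigma> \<subseteq> \<tau> \<longrightarrow> cond_indep p \<sigma> (\<tau> - Cl G \<sigma>) (pa_D G \<tau>))
     \<and> (\<forall>\<sigma>. \<sigma> \<subseteq> \<tau> \<longrightarrow> cond_indep p \<sigma> (pa_D G \<tau> - pa G \<sigma>) (pa G \<sigma> \<union> nb G \<sigma>)))"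

text \<open>
  Variable \<open>X\<^sub>v\<close> takes values in \<open>{1..d v}\<close>. A positive probability vector is a \<open>pmf\<close> whose support
  is the whole state space (the values outside \<open>V\<close> being irrelevant and fixed by \<open>Pi\<^sub>E\<close>).
\<close>

definition positive_on :: "'v set \<Rightarrow> ('v \<Rightarrow> nat) \<Rightarrow> ('v \<Rightarrow> nat) pmf \<Rightarrow> bool" where
  "positive_on V d p \<longleftrightarrow> set_pmf p = (\<Pi>\<^sub>E v\<in>V. {1..d v})"

definition P_III :: "'v mixed_graph \<Rightarrow> ('v \<Rightarrow> nat) \<Rightarrow> ('v \<Rightarrow> nat) pmf set" where
  "P_III G d = {p. positive_on (verts G) d p \<and> block_recursive_III G p}"

definition joint :: "(nat \<Rightarrow> nat) pmf \<Rightarrow> nat \<Rightarrow> nat \<Rightarrow> nat \<Rightarrow> nat \<Rightarrow> real" where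
  "joint p i j k l = \<P>(x in p. x 1 = i \<and> x 2 = j \<and> x 3 = k \<and> x 4 = l)"

definition G\<^sub>4 :: "nat mixed_graph" where
  "G\<^sub>4 = \<lparr>verts = {1, 2, 3, 4}, arrows = {(1, 3)}, lines = {(2, 3), (3, 2), (3, 4), (4, 3)}\<rparr>"


section \<open>Checks of the definitions\<close>

lemma G4_lines_rtrancl:
  "(lines G\<^sub>4)\<^sup>* `` {1} = {1}" "v \<in> {2, 3, 4} \<Longrightarrow> (lines G\<^sub>4)\<^sup>* `` {v} = {2, 3, 4}"
proof -
  have closed: "b \<in> S" if "(a, b) \<in> (lines G\<^sub>4)\<^sup>*" "a \<in> S" "S = {1} \<or> S = {2, 3, 4}" for a b S
    using that by (induction rule: rtrancl_induct) (auto simp: G\<^sub>4_def)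
  show "(lines G\<^sub>4)\<^sup>* `` {1} = {1}"
    using closed[of 1 _ "{1}"] by auto
  assume v: "v \<in> {2, 3, 4}"
  have L: "(2, 3) \<in> lines G\<^sub>4" "(3, 2) \<in> lines G\<^sub>4" "(3, 4) \<in> lines G\<^sub>4" "(4, 3) \<in> lines G\<^sub>4"
    by (auto simp: G\<^sub>4_def)
  have "(v, 3) \<in> (lines G\<^sub>4)\<^sup>*"
    using v L by auto
  then have "{2, 3, 4} \<subseteq> (lines G\<^sub>4)\<^sup>* `` {v}"
    using L by (auto intro: rtrancl_into_rtrancl)
  then show "(lines G\<^sub>4)\<^sup>* `` {v} = {2, 3, 4}"
    using closed[of v _ "{2, 3, 4}"] v by blast
qed

lemma chain_graph_G4: "chain_graph G\<^sub>4"
proof -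
  have "b \<in> {2, 3, 4}" if "(3, b) \<in> (arrows G\<^sub>4 \<union> lines G\<^sub>4)\<^sup>*" for b
    using that by (induction rule: rtrancl_induct) (auto simp: G\<^sub>4_def)
  from this[of 1] show ?thesis
    by (auto simp: chain_graph_def G\<^sub>4_def sym_def irrefl_def)
qed

lemma chain_components_G4: "chain_components G\<^sub>4 = {{1}, {2, 3, 4}}"
proof -
  have "chain_components G\<^sub>4 = (\<lambda>v. (lines G\<^sub>4)\<^sup>* `` {v}) ` {1, 2, 3, 4}"
    by (simp add: chain_components_def G\<^sub>4_def)
  also have "\<dots> = {{1}, {2, 3, 4}}"
    using G4_lines_rtrancl(1) G4_lines_rtrancl(2)[of 2] G4_lines_rtrancl(2)[of 3]
      G4_lines_rtrancl(2)[of 4]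
    by (simp only: image_insert image_empty) auto
  finally show ?thesis .
qed

lemma comp_dag_G4: "comp_dag G\<^sub>4 = {({1}, {2, 3, 4})}"
proof -
  have "comp_dag G\<^sub>4 = {(\<tau>, \<tau>'). \<tau> \<in> {{1}, {2, 3, 4}} \<and> \<tau>' \<in> {{1}, {2, 3, 4}} \<and> 1 \<in> \<tau> \<and> 3 \<in> \<tau>'}"
    unfolding comp_dag_def chain_components_G4 by (simp add: G\<^sub>4_def)
  also have "\<dots> = {({1}, {2, 3, 4})}"
    by (intro equalityI subsetI; clarsimp; elim disjE; simp)
  finally show ?thesis .
qed

lemma pa_D_G4: "pa_D G\<^sub>4 {1} = {}" "pa_D G\<^sub>4 {2, 3, 4} = {1}"
  by (auto simp: pa_D_def comp_dag_G4)

lemma nd_D_G4: "nd_D G\<^sub>4 {1} = {}" "nd_D G\<^sub>4 {2, 3, 4} = {1}"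
proof -
  have "b = {2, 3, 4}" if "({2, 3, 4}, b) \<in> (comp_dag G\<^sub>4)\<^sup>*" for b
    using that by (induction rule: rtrancl_induct) (auto simp: comp_dag_G4)
  from this[of "{1}"] show "nd_D G\<^sub>4 {2, 3, 4} = {1}"
    by (auto simp: nd_D_def chain_components_G4)
  have "({1}, {2, 3, 4}) \<in> (comp_dag G\<^sub>4)\<^sup>*"
    by (auto simp: comp_dag_G4)
  then show "nd_D G\<^sub>4 {1} = {}"
    by (auto simp: nd_D_def chain_components_G4)
qed

lemma cond_indep_sym: "cond_indep p \<alpha> \<beta> \<gamma> \<Longrightarrow> cond_indep p \<beta> \<alpha> \<gamma>"
  unfolding cond_indep_def by (auto simp: conj_commute mult.commute)

lemma cond_indep_empty: "cond_indep p \<alpha> {} \<gamma>"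
  unfolding cond_indep_def
proof (intro allI)
  fix a b c
  show "\<P>(x in p. restrict x \<alpha> = a \<and> restrict x {} = b \<bar> restrict x \<gamma> = c)
     = \<P>(x in p. restrict x \<alpha> = a \<bar> restrict x \<gamma> = c)
       * \<P>(x in p. restrict x {} = b \<bar> restrict x \<gamma> = c)"
  proof (cases "b = (\<lambda>_. undefined) \<and> \<P>(x in p. restrict x \<gamma> = c) \<noteq> 0")
    case False
    then show ?thesis
      by (cases "b = (\<lambda>_. undefined)") (auto simp: cond_prob_def restrict_def)
  qed (simp add: cond_prob_def restrict_def)
qed

lemma cond_indep_subset:
  fixes p :: "('v \<Rightarrow> 'a) pmf"
  assumes "cond_indep p \<alpha> \<beta> \<gamma>" "\<alpha>' \<subseteq> \<alpha>" "finite (set_pmf p)"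
  shows "cond_indep p \<alpha>' \<beta> \<gamma>"
  unfolding cond_indep_def
proof (intro allI)
  fix a b c
  let ?A = "(\<lambda>x. restrict x \<alpha>) ` {x \<in> set_pmf p. restrict x \<alpha>' = a}"
  have fin: "finite ?A" using assms by auto
  have *: "\<P>(x in p. restrict x \<alpha>' = a \<and> Q x) = (\<Sum>a'\<in>?A. \<P>(x in p. restrict x \<alpha> = a' \<and> Q x))"
    for Q
  proof -
    have restr: "restrict x \<alpha>' = restrict (restrict x \<alpha>) \<alpha>'" for x :: "'v \<Rightarrow> 'a"
      using assms(2) by (auto simp: restrict_def fun_eq_iff)
    have "\<P>(x in p. restrict x \<alpha>' = a \<and> Q x)
        = measure p (\<Union>a'\<in>?A. {x. restrict x \<alpha> = a' \<and> Q x})"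
    proof -
      have "{x. restrict x \<alpha>' = a \<and> Q x} \<inter> set_pmf p
          = (\<Union>a'\<in>?A. {x. restrict x \<alpha> = a' \<and> Q x}) \<inter> set_pmf p" (is "?l = ?r")
      proof
        show "?r \<subseteq> ?l"
          using restr by (auto, metis)
      qed auto
      then show ?thesis
        by (metis (no_types, lifting) Collect_cong UNIV_I measure_Int_set_pmf space_measure_pmf)
    qed
    also have "\<dots> = (\<Sum>a'\<in>?A. measure p {x. restrict x \<alpha> = a' \<and> Q x})"
      by (intro measure_pmf.finite_measure_finite_Union fin) (auto simp: disjoint_family_on_def)
    finally show ?thesis by simp
  qed
  have "\<P>(x in p. restrict x \<alpha>' = a \<and> restrict x \<beta> = b \<bar> restrict x \<gamma> = c)
      = (\<Sum>a'\<in>?A. \<P>(x in p. restrict x \<alpha> = a' \<and> restrict x \<beta> = b \<bar> restrict x \<gamma> = c))"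
    using *[of "\<lambda>x. restrict x \<beta> = b \<and> restrict x \<gamma> = c"]
    by (simp add: cond_prob_def sum_divide_distrib conj_assoc)
  also have "\<dots> = (\<Sum>a'\<in>?A. \<P>(x in p. restrict x \<alpha> = a' \<bar> restrict x \<gamma> = c)
      * \<P>(x in p. restrict x \<beta> = b \<bar> restrict x \<gamma> = c))"
    using assms(1) by (simp add: cond_indep_def)
  also have "\<dots> = \<P>(x in p. restrict x \<alpha>' = a \<bar> restrict x \<gamma> = c)
      * \<P>(x in p. restrict x \<beta> = b \<bar> restrict x \<gamma> = c)"
    using *[of "\<lambda>x. restrict x \<gamma> = c"]
    by (simp add: cond_prob_def sum_divide_distrib sum_distrib_right)
  finally show "\<P>(x in p. restrict x \<alpha>' = a \<and> restrict x \<beta> = b \<bar> restrict x \<gamma> = c)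
     = \<P>(x in p. restrict x \<alpha>' = a \<bar> restrict x \<gamma> = c)
       * \<P>(x in p. restrict x \<beta> = b \<bar> restrict x \<gamma> = c)" .
qed

lemma P_III_G4:
  "p \<in> P_III G\<^sub>4 d \<longleftrightarrow>
     positive_on {1, 2, 3, 4} d p \<and> cond_indep p {2} {4} {1} \<and> cond_indep p {1} {2, 4} {3}"
proof -
  have pa: "pa G\<^sub>4 \<sigma> = (if 3 \<in> \<sigma> then {1} else {})" for \<sigma>
    by (auto simp: pa_def G\<^sub>4_def)
  have nb: "nb G\<^sub>4 \<sigma> = (if 2 \<in> \<sigma> \<or> 4 \<in> \<sigma> then {3} else {}) \<union> (if 3 \<in> \<sigma> then {2, 4} else {}) - \<sigma>" for \<sigma>
    by (auto simp: nb_def G\<^sub>4_def)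
  have V: "verts G\<^sub>4 = {1, 2, 3, 4}" by (simp add: G\<^sub>4_def)
  have empty: "cond_indep p {} \<beta> \<gamma>" for \<beta> \<gamma>
    by (rule cond_indep_sym[OF cond_indep_empty])
  show ?thesis
  proof (intro iffI conjI; (elim conjE)?)
    assume p: "p \<in> P_III G\<^sub>4 d"
    then have B: "block_recursive_III G\<^sub>4 p" by (simp add: P_III_def)
    show "positive_on {1, 2, 3, 4} d p" using p by (simp add: P_III_def V)
    have "cond_indep p {2} ({2, 3, 4} - Cl G\<^sub>4 {2}) {1}"
      using B by (simp add: block_recursive_III_def chain_components_G4 pa_D_G4)
    moreover have "{2, 3, 4} - Cl G\<^sub>4 {2} = {4}" by (auto simp: Cl_def nb)
    ultimately show "cond_indep p {2} {4} {1}" by simp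
    have "cond_indep p {2, 4} ({1} - pa G\<^sub>4 {2, 4}) (pa G\<^sub>4 {2, 4} \<union> nb G\<^sub>4 {2, 4})"
      using B by (simp add: block_recursive_III_def chain_components_G4 pa_D_G4)
    then show "cond_indep p {1} {2, 4} {3}" by (simp add: pa nb cond_indep_sym)
  next
    assume pos: "positive_on {1, 2, 3, 4} d p" and c1: "cond_indep p {2} {4} {1}"
      and c2: "cond_indep p {1} {2, 4} {3}"
    have fin: "finite (set_pmf p)"
      using pos by (auto simp: positive_on_def intro!: finite_PiE)
    have s1: "cond_indep p \<sigma> ({2, 3, 4} - Cl G\<^sub>4 \<sigma>) {1}" if sub: "\<sigma> \<subseteq> {2, 3, 4}" for \<sigma>
    proof -
      consider "\<sigma> = {}" | "\<sigma> = {2}" | "\<sigma> = {4}" | "{2, 3, 4} - Cl G\<^sub>4 \<sigma> = {}"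
      proof (cases "\<sigma> = {} \<or> \<sigma> = {2} \<or> \<sigma> = {4}")
        case False
        then have "3 \<in> \<sigma> \<or> {2, 4} \<subseteq> \<sigma>" using sub by auto
        then have "{2, 3, 4} - Cl G\<^sub>4 \<sigma> = {}" by (auto simp: Cl_def nb)
        then show thesis using that by blast
      qed (use that in blast)
      then show ?thesis
      proof cases
        case 2
        moreover have "{2, 3, 4} - Cl G\<^sub>4 {2} = {4}" by (auto simp: Cl_def nb)
        ultimately show ?thesis using c1 by simp
      next
        case 3
        moreover have "{2, 3, 4} - Cl G\<^sub>4 {4} = {2}" by (auto simp: Cl_def nb)
        ultimately show ?thesis using cond_indep_sym[OF c1] by simp
      next
        case 4
        then show ?thesis by (simp only: cond_indep_empty)
      qed (simp add: empty)
    qed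
    have s2: "cond_indep p \<sigma> ({1} - pa G\<^sub>4 \<sigma>) (pa G\<^sub>4 \<sigma> \<union> nb G\<^sub>4 \<sigma>)" if "\<sigma> \<subseteq> {2, 3, 4}" for \<sigma>
    proof (cases "3 \<in> \<sigma> \<or> \<sigma> = {}")
      case True
      then show ?thesis by (auto simp: pa cond_indep_empty empty)
    next
      case False
      then have "\<sigma> \<subseteq> {2, 4}" "2 \<in> \<sigma> \<or> 4 \<in> \<sigma>" using that by auto
      then have "cond_indep p \<sigma> {1} {3}"
        using cond_indep_subset[OF cond_indep_sym[OF c2] _ fin] by blast
      moreover have "nb G\<^sub>4 \<sigma> = {3}"
        using False \<open>2 \<in> \<sigma> \<or> 4 \<in> \<sigma>\<close> by (auto simp: nb)
      ultimately show ?thesis using False by (simp add: pa)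
    qed
    have s0: "cond_indep p \<sigma> ({1} - Cl G\<^sub>4 \<sigma>) {}" if "\<sigma> \<subseteq> {1}" for \<sigma>
      using that by (auto simp: subset_singleton_iff empty Cl_def cond_indep_empty)
    show "p \<in> P_III G\<^sub>4 d"
      unfolding P_III_def V block_recursive_III_def chain_components_G4
      using pos s0 s1 s2
      by (simp add: cond_indep_empty pa_D_G4 nd_D_G4 del: One_nat_def)
  qed
qed

lemma marg_indep_iff_cond_indep: "marg_indep p \<alpha> \<beta> \<longleftrightarrow> cond_indep p \<alpha> \<beta> {}"
proof -
  let ?X = "\<lambda>x. restrict x \<alpha>" and ?Y = "\<lambda>x. restrict x \<beta>"
  let ?prod = "\<forall>a b. measure p {x. ?X x = a \<and> ?Y x = b} = measure p {x. ?X x = a} * measure p {x. ?Y x = b}"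
  have "?prod" if "marg_indep p \<alpha> \<beta>"
  proof (intro allI)
    fix a b
    show "measure p {x. ?X x = a \<and> ?Y x = b} = measure p {x. ?X x = a} * measure p {x. ?Y x = b}"
      using prob_space.indep_varD[OF measure_pmf.prob_space_axioms that[unfolded marg_indep_def], of "{a}" "{b}"]
      by (simp add: vimage_def)
  qed
  moreover have "marg_indep p \<alpha> \<beta>" if "?prod"
  proof -
    have eq: "map_pmf (\<lambda>x. (?X x, ?Y x)) p = pair_pmf (map_pmf ?X p) (map_pmf ?Y p)"
    proof (rule pmf_eqI)
      fix ab
      show "pmf (map_pmf (\<lambda>x. (?X x, ?Y x)) p) ab = pmf (pair_pmf (map_pmf ?X p) (map_pmf ?Y p)) ab"
        using that by (cases ab) (simp add: pmf_pair pmf_map vimage_def)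
    qed
    have prod: "measure p (?X -` A \<inter> ?Y -` B) = measure p (?X -` A) * measure p (?Y -` B)" for A B
    proof -
      have "measure p (?X -` A \<inter> ?Y -` B) = measure (map_pmf (\<lambda>x. (?X x, ?Y x)) p) (A \<times> B)"
        by (simp add: measure_map_pmf vimage_def Int_def)
      also have "\<dots> = measure (pair_pmf (map_pmf ?X p) (map_pmf ?Y p)) (A \<times> B)"
        by (simp only: eq)
      also have "\<dots> = measure (pair_pmf (map_pmf ?X p) (map_pmf ?Y p))
          ((A \<inter> set_pmf (map_pmf ?X p)) \<times> (B \<inter> set_pmf (map_pmf ?Y p)))"
        by (subst (1 2) measure_Int_set_pmf[symmetric]) (rule arg_cong[where f = "measure _"], auto)
      also have "\<dots> = measure (map_pmf ?X p) (A \<inter> set_pmf (map_pmf ?X p))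
          * measure (map_pmf ?Y p) (B \<inter> set_pmf (map_pmf ?Y p))"
        by (intro measure_pmf_prob_product countable_Int2 countable_set_pmf)
      also have "\<dots> = measure p (?X -` A) * measure p (?Y -` B)"
        by (simp only: measure_Int_set_pmf measure_map_pmf)
      finally show ?thesis .
    qed
    have stable: "Int_stable {Z -` A \<inter> space (measure_pmf p) |A. A \<in> sets (count_space UNIV)}" for Z :: "_ \<Rightarrow> 'a \<Rightarrow> 'b"
      by (simp add: Int_stable_def) (metis vimage_Int)
    show ?thesis
      unfolding marg_indep_def prob_space.indep_var_eq[OF measure_pmf.prob_space_axioms]
      by (intro conjI prob_space.indep_set_sigma_sets[OF measure_pmf.prob_space_axioms] stable)
        (auto intro!: prob_space.indep_setI[OF measure_pmf.prob_space_axioms] simp: prod)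
  qed
  moreover have "cond_indep p \<alpha> \<beta> {} \<longleftrightarrow> ?prod"
  proof -
    have "\<P>(x in p. Q x \<bar> restrict x {} = c) = (if c = (\<lambda>_. undefined) then measure p {x. Q x} else 0)"
      for Q c
      by (auto simp: cond_prob_def restrict_def)
    then show ?thesis
      unfolding cond_indep_def by (simp split: if_splits)
  qed
  ultimately show ?thesis by blast
qed

end

theory Submission
  imports Defs
begin

text \<open>
  Given \<open>1 \<bottom> {2,4} | 3\<close>, the \<open>2 \<times> 2\<close> matrix of \<open>P(X\<^sub>1 = i, X\<^sub>2 = j, X\<^sub>4 = l)\<close> is
  \<open>a\<^sub>i\<^sub>1 M\<^sub>1 + a\<^sub>i\<^sub>2 M\<^sub>2\<close> with \<open>a\<^sub>i\<^sub>k = P(X\<^sub>1 = i, X\<^sub>3 = k)\<close> and \<open>M\<^sub>k\<close> the conditional distribution of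
  \<open>(X\<^sub>2, X\<^sub>4)\<close> given \<open>X\<^sub>3 = k\<close>. Independence of 2 and 4 given 1 says that its determinant vanishes, so
  both ratios \<open>a\<^sub>i\<^sub>1/a\<^sub>i\<^sub>2\<close> are roots of the same quadratic polynomial with leading coefficient \<open>det M\<^sub>1\<close>
  and constant term \<open>det M\<^sub>2\<close>. If the ratios differ, Vieta's formula for the product of the roots is
  equivalent to each of the two equations in (ii). If they agree, 1 is independent of 3, and (i)
  follows.
\<close>

section \<open>Conditional independence as product identities\<close>

text \<open>Multiply the defining equation by the square of the probability of the conditioning
  event; if that is 0, every term vanishes. Ranging over assignments \<open>u\<close>,
  \<open>v\<close>, \<open>w\<close> turns equations between restrictions into pointwise
  ones.\<close>

lemma cond_indep_iff_prob_mult: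
  "cond_indep p \<alpha> \<beta> \<gamma> \<longleftrightarrow> (\<forall>u v w.
     \<P>(x in p. (\<forall>s\<in>\<alpha>. x s = u s) \<and> (\<forall>s\<in>\<beta>. x s = v s) \<and> (\<forall>s\<in>\<gamma>. x s = w s))
       * \<P>(x in p. \<forall>s\<in>\<gamma>. x s = w s)
     = \<P>(x in p. (\<forall>s\<in>\<alpha>. x s = u s) \<and> (\<forall>s\<in>\<gamma>. x s = w s))
       * \<P>(x in p. (\<forall>s\<in>\<beta>. x s = v s) \<and> (\<forall>s\<in>\<gamma>. x s = w s)))"
  (is "_ \<longleftrightarrow> (\<forall>u v w. ?E u v w)")
proof -
  let ?C = "\<lambda>a b c.
     \<P>(x in p. restrict x \<alpha> = a \<and> restrict x \<beta> = b \<bar> restrict x \<gamma> = c)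
     = \<P>(x in p. restrict x \<alpha> = a \<bar> restrict x \<gamma> = c)
       * \<P>(x in p. restrict x \<beta> = b \<bar> restrict x \<gamma> = c)"
  have restrict_eq: "restrict x A = restrict u A \<longleftrightarrow> (\<forall>s\<in>A. x s = u s)"
    for x u :: "'a \<Rightarrow> 'b" and A
    by (auto simp: restrict_def fun_eq_iff)
  have CE: "?C (restrict u \<alpha>) (restrict v \<beta>) (restrict w \<gamma>) \<longleftrightarrow> ?E u v w" for u v w
  proof (cases "\<P>(x in p. \<forall>s\<in>\<gamma>. x s = w s) = 0")
    case True
    have "\<P>(x in p. R x \<and> (\<forall>s\<in>\<gamma>. x s = w s)) = 0" for R
    proof -
      have "\<P>(x in p. R x \<and> (\<forall>s\<in>\<gamma>. x s = w s)) \<le> \<P>(x in p. \<forall>s\<in>\<gamma>. x s = w s)"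
        by (intro measure_pmf.finite_measure_mono) auto
      then show ?thesis
        using True by (simp add: measure_le_0_iff)
    qed
    then show ?thesis
      using True by (simp add: cond_prob_def restrict_eq)
  next
    case False
    then show ?thesis
      by (auto simp: cond_prob_def restrict_eq field_simps)
  qed
  have "?C a b c" if all: "\<forall>u v w. ?C (restrict u \<alpha>) (restrict v \<beta>) (restrict w \<gamma>)" for a b c
  proof -
    \<comment> \<open>A value that is not the restriction of any assignment describes an empty
      event, so both sides are 0.\<close>
    consider u v w where "a = restrict u \<alpha>" "b = restrict v \<beta>" "c = restrict w \<gamma>"
      | "\<forall>x. restrict x \<alpha> \<noteq> a" | "\<forall>x. restrict x \<beta> \<noteq> b" | "\<forall>x. restrict x \<gamma> \<noteq> c"
      by blast
    then show ?thesis
    proof cases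
      case 1
      with all show ?thesis by blast
    qed (simp_all add: cond_prob_def)
  qed
  then have "cond_indep p \<alpha> \<beta> \<gamma>
      \<longleftrightarrow> (\<forall>u v w. ?C (restrict u \<alpha>) (restrict v \<beta>) (restrict w \<gamma>))"
    unfolding cond_indep_def by blast
  then show ?thesis
    unfolding CE .
qed

text \<open>
  Vieta's formula for the product of the roots \<open>a1/b1\<close> and \<open>a2/b2\<close>, in homogeneous form so that
  \<open>A = 0\<close> is allowed.
\<close>

lemma binary_form_roots_prod:
  fixes A B C a1 b1 a2 b2 :: real
  assumes "A * a1\<^sup>2 + B * a1 * b1 + C * b1\<^sup>2 = 0" "A * a2\<^sup>2 + B * a2 * b2 + C * b2\<^sup>2 = 0"
    and "a1 * b2 \<noteq> a2 * b1"
  shows "A * a1 * a2 = C * b1 * b2"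
proof -
  \<comment> \<open>These multipliers cancel the terms in \<open>B\<close>; what remains has the
    factor \<open>a1 * b2 - a2 * b1\<close>.\<close>
  have "(a1 * b2 - a2 * b1) * (A * a1 * a2 - C * b1 * b2) =
      a2 * b2 * (A * a1\<^sup>2 + B * a1 * b1 + C * b1\<^sup>2) - a1 * b1 * (A * a2\<^sup>2 + B * a2 * b2 + C * b2\<^sup>2)"
    by algebra
  then show ?thesis
    using assms by simp
qed

section \<open>Cells and margins of a positive binary distribution\<close>

locale binary_pmf =
  fixes p :: "(nat \<Rightarrow> nat) pmf" and d :: "nat \<Rightarrow> nat"
  assumes d: "d 1 = 2" "d 2 = 2" "d 3 = 2" "d 4 = 2"
    and positive: "positive_on {1, 2, 3, 4} d p"
begin

lemma coordinate_cases:
  fixes x :: "nat \<Rightarrow> nat"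
  assumes "x \<in> set_pmf p" "s \<in> {1, 2, 3, 4}"
  shows "x s = 1 \<or> x s = 2"
proof -
  have "x s \<in> {1..d s}"
    using assms positive by (auto simp: positive_on_def PiE_def Pi_def)
  moreover have "d s = 2"
    using assms(2) d by auto
  ultimately show ?thesis by auto
qed

lemma prob_split:
  assumes "s \<in> {1, 2, 3, 4}"
  shows "\<P>(x in p. R x) = \<P>(x in p. R x \<and> x s = 1) + \<P>(x in p. R x \<and> x s = 2)"
proof -
  have "measure p {x. R x} = measure p ({x. R x \<and> x s = 1} \<union> {x. R x \<and> x s = 2})"
    using coordinate_cases[OF _ assms]
    by (intro measure_eq_AE) (auto simp: AE_measure_pmf_iff)
  also have "\<dots> = measure p {x. R x \<and> x s = 1} + measure p {x. R x \<and> x s = 2}"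
    by (intro measure_pmf.finite_measure_Union) auto
  finally show ?thesis by simp
qed

text \<open>The product identities below range over all natural indices, so cells outside the state
  space must be settled too.\<close>

lemma joint_eq_0:
  assumes "i \<notin> {1, 2} \<or> j \<notin> {1, 2} \<or> k \<notin> {1, 2} \<or> l \<notin> {1, 2}"
  shows "joint p i j k l = 0"
proof (rule ccontr)
  assume "joint p i j k l \<noteq> 0"
  then obtain x where x: "x \<in> set_pmf p" and eqs: "x 1 = i" "x 2 = j" "x 3 = k" "x 4 = l"
    by (auto simp: joint_def measure_pmf_zero_iff)
  show False
    using assms coordinate_cases[OF x, of 1] coordinate_cases[OF x, of 2]
      coordinate_cases[OF x, of 3] coordinate_cases[OF x, of 4]
    unfolding eqs by blast
qed

lemma joint_pos:
  assumes "i \<in> {1, 2}" "j \<in> {1, 2}" "k \<in> {1, 2}" "l \<in> {1, 2}"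
  shows "joint p i j k l > 0"
proof -
  \<comment> \<open>The support consists of extensional functions, hence the restriction to the four
    vertices.\<close>
  define x :: "nat \<Rightarrow> nat" where
    "x = restrict ((\<lambda>_. undefined)(1 := i, 2 := j, 3 := k, 4 := l)) {1, 2, 3, 4}"
  have "x \<in> set_pmf p"
    using assms d positive by (auto simp: positive_on_def x_def)
  moreover have "x 1 = i \<and> x 2 = j \<and> x 3 = k \<and> x 4 = l"
    by (simp add: x_def)
  ultimately show ?thesis
    unfolding joint_def by (intro measure_pmf_posI[of x]) auto
qed

text \<open>The digits name the coordinates kept. Written as sums of cells, margins are related by
  plain algebra.\<close>

definition "m124 i j l = joint p i j 1 l + joint p i j 2 l"
definition "m234 j k l = joint p 1 j k l + joint p 2 j k l"
definition "m12 i j = m124 i j 1 + m124 i j 2"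
definition "m13 i k = joint p i 1 k 1 + joint p i 1 k 2 + (joint p i 2 k 1 + joint p i 2 k 2)"
definition "m14 i l = m124 i 1 l + m124 i 2 l"
definition "m24 j l = m124 1 j l + m124 2 j l"
definition "m1 i = m12 i 1 + m12 i 2"
definition "m2 j = m12 1 j + m12 2 j"
definition "m3 k = m13 1 k + m13 2 k"
definition "m4 l = m14 1 l + m14 2 l"

lemmas margin_defs =
  m124_def m234_def m12_def m13_def m14_def m24_def m1_def m2_def m3_def m4_def

lemma prob_eq_margin:
  "\<P>(x in p. x 1 = i \<and> x 2 = j \<and> x 4 = l) = m124 i j l"
  "\<P>(x in p. x 2 = j \<and> x 3 = k \<and> x 4 = l) = m234 j k l"
  "\<P>(x in p. x 1 = i \<and> x 2 = j) = m12 i j"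
  "\<P>(x in p. x 1 = i \<and> x 3 = k) = m13 i k"
  "\<P>(x in p. x 1 = i \<and> x 4 = l) = m14 i l"
  "\<P>(x in p. x 1 = i) = m1 i"
  "\<P>(x in p. x 2 = j) = m2 j"
  "\<P>(x in p. x 3 = k) = m3 k"
proof -
  show m124: "\<P>(x in p. x 1 = i \<and> x 2 = j \<and> x 4 = l) = m124 i j l" for i j l
    by (subst prob_split[of 3]) (simp_all add: m124_def joint_def conj_ac)
  show "\<P>(x in p. x 2 = j \<and> x 3 = k \<and> x 4 = l) = m234 j k l"
    by (subst prob_split[of 1]) (simp_all add: m234_def joint_def conj_ac)
  show m12: "\<P>(x in p. x 1 = i \<and> x 2 = j) = m12 i j" for i j
    by (subst prob_split[of 4]) (simp_all add: m12_def m124[symmetric] conj_ac)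
  show m14: "\<P>(x in p. x 1 = i \<and> x 4 = l) = m14 i l" for i l
    by (subst prob_split[of 2]) (simp_all add: m14_def m124[symmetric] conj_ac)
  show m13: "\<P>(x in p. x 1 = i \<and> x 3 = k) = m13 i k" for i k
    by (subst prob_split[of 2], simp, subst (1 2) prob_split[of 4])
      (simp_all add: m13_def joint_def conj_ac)
  show "\<P>(x in p. x 1 = i) = m1 i"
    by (subst prob_split[of 2]) (simp_all add: m1_def m12[symmetric] conj_ac)
  show "\<P>(x in p. x 2 = j) = m2 j"
    by (subst prob_split[of 1]) (simp_all add: m2_def m12[symmetric] conj_ac)
  show "\<P>(x in p. x 3 = k) = m3 k"
    by (subst prob_split[of 1]) (simp_all add: m3_def m13[symmetric] conj_ac)
qed

lemma m1_sum: "m1 1 + m1 2 = 1"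
proof -
  have "\<P>(x in p. True) = m1 1 + m1 2"
    by (subst prob_split[of 1]) (simp_all only: insertI1 simp_thms prob_eq_margin)
  then show ?thesis
    using measure_pmf.prob_space[of p] by simp
qed

section \<open>The four independence statements in terms of margins\<close>

lemma cond_indep_2_4_given_1:
  "cond_indep p {2} {4} {1} \<longleftrightarrow> (\<forall>i j l. m124 i j l * m1 i = m12 i j * m14 i l)"
  (is "?C \<longleftrightarrow> ?R")
proof
  assume ?C
  show ?R
  proof (intro allI)
    fix i j l
    show "m124 i j l * m1 i = m12 i j * m14 i l"
      using \<open>?C\<close>[unfolded cond_indep_iff_prob_mult, rule_format, of "\<lambda>_. j" "\<lambda>_. l" "\<lambda>_. i"]
      by (simp add: prob_eq_margin[symmetric] conj_ac)
  qed
next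
  assume ?R
  then show ?C
    by (simp add: cond_indep_iff_prob_mult prob_eq_margin[symmetric] conj_ac)
qed

lemma cond_indep_1_24_given_3:
  "cond_indep p {1} {2, 4} {3} \<longleftrightarrow>
   (\<forall>i j k l. joint p i j k l * m3 k = m13 i k * m234 j k l)"
  (is "?C \<longleftrightarrow> ?R")
proof
  assume ?C
  show ?R
  proof (intro allI)
    fix i j k l
    \<comment> \<open>The assignment \<open>(\<lambda>_. l)(2 := j)\<close> prescribes
      \<open>j\<close> at vertex 2 and \<open>l\<close> at vertex 4.\<close>
    show "joint p i j k l * m3 k = m13 i k * m234 j k l"
      using \<open>?C\<close>[unfolded cond_indep_iff_prob_mult, rule_format,
          of "\<lambda>_. i" "(\<lambda>_. l)(2 := j)" "\<lambda>_. k"]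
      by (simp add: prob_eq_margin[symmetric] joint_def conj_ac)
  qed
next
  assume ?R
  then show ?C
    by (simp add: cond_indep_iff_prob_mult prob_eq_margin[symmetric] joint_def conj_ac)
qed

lemma marg_indep_1_234:
  "marg_indep p {1} {2, 3, 4} \<longleftrightarrow> (\<forall>i j k l. joint p i j k l = m1 i * m234 j k l)"
  (is "?C \<longleftrightarrow> ?R")
proof
  assume ?C
  show ?R
  proof (intro allI)
    fix i j k l
    \<comment> \<open>The empty conditioning set contributes the factor
      \<open>\<P>(x in p. True)\<close>, which is 1.\<close>
    show "joint p i j k l = m1 i * m234 j k l"
      using \<open>?C\<close>[unfolded marg_indep_iff_cond_indep cond_indep_iff_prob_mult, rule_format,
          of "\<lambda>_. i" "(\<lambda>_. l)(2 := j, 3 := k)"] measure_pmf.prob_space[of p]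
      by (simp add: prob_eq_margin[symmetric] joint_def conj_ac)
  qed
next
  assume ?R
  then show ?C
    using measure_pmf.prob_space[of p]
    by (simp add: marg_indep_iff_cond_indep cond_indep_iff_prob_mult prob_eq_margin[symmetric]
        joint_def conj_ac)
qed

lemma marg_indep_2_14:
  "marg_indep p {2} {1, 4} \<longleftrightarrow> (\<forall>i j l. m124 i j l = m2 j * m14 i l)"
  (is "?C \<longleftrightarrow> ?R")
proof
  assume ?C
  show ?R
  proof (intro allI)
    fix i j l
    show "m124 i j l = m2 j * m14 i l"
      using \<open>?C\<close>[unfolded marg_indep_iff_cond_indep cond_indep_iff_prob_mult, rule_format,
          of "\<lambda>_. j" "(\<lambda>_. l)(1 := i)"] measure_pmf.prob_space[of p]
      by (simp add: prob_eq_margin[symmetric] conj_ac)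
  qed
next
  assume ?R
  then show ?C
    using measure_pmf.prob_space[of p]
    by (simp add: marg_indep_iff_cond_indep cond_indep_iff_prob_mult prob_eq_margin[symmetric]
        conj_ac)
qed

lemma margins_pos:
  assumes "i \<in> {1, 2}" "k \<in> {1, 2}"
  shows "m13 i k > 0" and "m1 i > 0" and "m3 k > 0"
proof -
  have m13: "m13 i k > 0" if "i \<in> {1, 2}" "k \<in> {1, 2}" for i k
    unfolding m13_def using that by (intro add_pos_pos joint_pos) auto
  show "m13 i k > 0"
    using assms by (rule m13)
  have "m1 i = m13 i 1 + m13 i 2"
    by (simp add: margin_defs)
  then show "m1 i > 0"
    using assms m13[of i 1] m13[of i 2] by simp
  show "m3 k > 0"
    unfolding m3_def using assms m13[of 1 k] m13[of 2 k] by simp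
qed

section \<open>From condition (i) to the model\<close>

text \<open>Summing \<open>D\<close> over \<open>l\<close> factorizes \<open>m12\<close>, and
  summing \<open>C\<close> over \<open>j\<close> and \<open>l\<close> factorizes \<open>m13\<close>;
  substitution does the rest.\<close>

lemma cond_indep_if_marg_indep:
  assumes C: "\<And>i j k l. joint p i j k l = m1 i * m234 j k l"
    and D: "\<And>i j l. m124 i j l = m2 j * m14 i l"
  shows "m124 i j l * m1 i = m12 i j * m14 i l"
    and "joint p i j k l * m3 k = m13 i k * m234 j k l"
proof -
  have "m12 i j = m2 j * m1 i"
  proof -
    have "m12 i j = m2 j * (m14 i 1 + m14 i 2)"
      unfolding m12_def D by (simp only: distrib_left)
    also have "m14 i 1 + m14 i 2 = m1 i"
      by (simp add: margin_defs)
    finally show ?thesis .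
  qed
  then show "m124 i j l * m1 i = m12 i j * m14 i l"
    by (simp add: D)
  have "m13 i k = m1 i * (m234 1 k 1 + m234 1 k 2 + (m234 2 k 1 + m234 2 k 2))" for i
    unfolding m13_def C[of i] by (simp only: distrib_left)
  moreover have "m234 1 k 1 + m234 1 k 2 + (m234 2 k 1 + m234 2 k 2) = m3 k"
    by (simp add: margin_defs)
  ultimately show "joint p i j k l * m3 k = m13 i k * m234 j k l"
    by (simp add: C)
qed

section \<open>From the model to condition (i) or the two equations\<close>

text \<open>By \<open>eq\<close> the table \<open>m13\<close> is singular, hence the product of its
  margins. Then \<open>B\<close> makes 1 independent of the other three, and \<open>A\<close> loses
  its dependence on 1 and says that 2 and 4 are independent.\<close>

lemma marg_indep_if_cond_indep:
  assumes A: "\<And>i j l. m124 i j l * m1 i = m12 i j * m14 i l"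
    and B: "\<And>i j k l. joint p i j k l * m3 k = m13 i k * m234 j k l"
    and eq: "m13 1 1 * m13 2 2 = m13 2 1 * m13 1 2"
  shows "joint p i j k l = m1 i * m234 j k l"
    and "m124 i j l = m2 j * m14 i l"
proof -
  have m1: "m1 i = m13 i 1 + m13 i 2" for i
    by (simp add: margin_defs)
  have total: "m13 1 1 + m13 1 2 + (m13 2 1 + m13 2 2) = 1"
    using m1_sum by (simp add: m1)
  \<comment> \<open>Multiply \<open>a\<close> by the total 1 and replace \<open>a * e\<close> by
    \<open>c * b\<close>.\<close>
  have rank1: "a = (a + b) * (a + c)" if "a + b + (c + e) = 1" "a * e = c * b" for a b c e :: real
  proof -
    have "a = a * (a + b + (c + e))"
      using that by simp
    also have "\<dots> = (a + b) * (a + c)"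
      using that(2) by (simp add: algebra_simps)
    finally show ?thesis .
  qed
  have m13: "m13 i k = m1 i * m3 k" if "i \<in> {1, 2}" "k \<in> {1, 2}" for i k
  proof -
    have "i' \<noteq> i \<Longrightarrow> k' \<noteq> k \<Longrightarrow> i' \<in> {1, 2} \<Longrightarrow> k' \<in> {1, 2} \<Longrightarrow>
        m13 i k = (m13 i k + m13 i k') * (m13 i k + m13 i' k)" for i' k'
      using that total eq by (intro rank1[where e = "m13 i' k'"]) (auto simp: algebra_simps)
    \<comment> \<open>On {1, 2} the map \<open>3 - i\<close> exchanges the two values.\<close>
    from this[of "3 - i" "3 - k"] show ?thesis
      using that unfolding m1 m3_def by (auto simp: algebra_simps)
  qed
  have C: "joint p i j k l = m1 i * m234 j k l" for i j k l
  proof (cases "i \<in> {1, 2} \<and> k \<in> {1, 2}")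
    case True
    then have "joint p i j k l * m3 k = m1 i * m234 j k l * m3 k"
      by (simp add: B m13)
    then show ?thesis
      using margins_pos(3)[of 1 k] True by simp
  next
    case False
    then show ?thesis
      by (auto simp: joint_eq_0 margin_defs)
  qed
  then show "joint p i j k l = m1 i * m234 j k l" .
  have m24: "m24 j l = m234 j 1 l + m234 j 2 l" for j l
    by (simp add: margin_defs)
  have m124: "m124 i j l = m1 i * m24 j l" for i j l
    unfolding m124_def m24 by (subst (1 2) C) (simp add: algebra_simps)
  have m12: "m12 i j = m1 i * m2 j" for i j
  proof -
    have "m12 i j = m1 i * (m24 j 1 + m24 j 2)"
      unfolding m12_def m124 by (simp only: distrib_left)
    also have "m24 j 1 + m24 j 2 = m2 j"
      by (simp add: m24_def m2_def m12_def)
    finally show ?thesis .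
  qed
  have m14: "m14 i l = m1 i * m4 l" for i l
  proof -
    have "m14 i l = m1 i * (m24 1 l + m24 2 l)"
      unfolding m14_def m124 by (simp only: distrib_left)
    also have "m24 1 l + m24 2 l = m4 l"
      by (simp add: m24_def m4_def m14_def)
    finally show ?thesis .
  qed
  \<comment> \<open>At \<open>i = 1\<close> both sides of \<open>A\<close> carry the square of
    \<open>m1 1\<close>, which is positive and cancels.\<close>
  have "m24 j l = m2 j * m4 l"
    using A[of 1 j l] margins_pos(2)[of 1 1] by (simp add: m124 m12 m14)
  then show "m124 i j l = m2 j * m14 i l"
    by (simp add: m124 m14)
qed

lemma joint_identity_if_cond_indep:
  assumes A: "\<And>i j l. m124 i j l * m1 i = m12 i j * m14 i l"
    and B: "\<And>i j k l. joint p i j k l * m3 k = m13 i k * m234 j k l"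
    and neq: "m13 1 1 * m13 2 2 \<noteq> m13 2 1 * m13 1 2"
  shows "joint p 1 1 2 1 * joint p 2 2 2 2 - joint p 1 1 2 2 * joint p 2 2 2 1
       = joint p 1 1 1 1 * joint p 2 2 1 2 - joint p 1 1 1 2 * joint p 2 2 1 1" (is ?E1)
    and "joint p 1 2 2 1 * joint p 2 1 2 2 - joint p 1 2 2 2 * joint p 2 1 2 1
       = joint p 1 2 1 1 * joint p 2 1 1 2 - joint p 1 2 1 2 * joint p 2 1 1 1" (is ?E2)
proof -
  \<comment> \<open>\<open>c k\<close> is the conditional table of the second and fourth variables
    given that the third is \<open>k\<close>, and \<open>\<Delta> k\<close> its determinant.\<close>
  define c where "c k j l = m234 j k l / m3 k" for j k l
  define \<Delta> where "\<Delta> k = c k 1 1 * c k 2 2 - c k 1 2 * c k 2 1" for k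
  have f: "joint p i j k l = m13 i k * c k j l" if "k \<in> {1, 2}" for i j k l
    using B[of i j k l] margins_pos(3)[of 1 k] that by (simp add: c_def field_simps)
  \<comment> \<open>The mixed coefficient of the determinant of \<open>s * c 1 + t * c 2\<close> as
    a form in \<open>s\<close> and \<open>t\<close>.\<close>
  let ?B = "c 1 1 1 * c 2 2 2 + c 2 1 1 * c 1 2 2 - c 1 1 2 * c 2 2 1 - c 2 1 2 * c 1 2 1"
  have quad: "\<Delta> 1 * (m13 i 1)\<^sup>2 + ?B * m13 i 1 * m13 i 2 + \<Delta> 2 * (m13 i 2)\<^sup>2 = 0" for i
  proof -
    \<comment> \<open>For a 2 by 2 table, the entry at (1, 1) times the total minus the product of
      its row and column sums is the determinant.\<close>
    have "m124 i 1 1 * m124 i 2 2 - m124 i 1 2 * m124 i 2 1 = 0"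
      using A[of i 1 1] unfolding m1_def m12_def m14_def by (simp add: algebra_simps)
    moreover have "m124 i j l = m13 i 1 * c 1 j l + m13 i 2 * c 2 j l" for j l
      by (simp add: m124_def f)
    ultimately show ?thesis
      by (simp add: \<Delta>_def power2_eq_square algebra_simps)
  qed
  have "\<Delta> 1 * m13 1 1 * m13 2 1 = \<Delta> 2 * m13 1 2 * m13 2 2"
    using binary_form_roots_prod[OF quad quad neq] .
  then have \<Delta>: "m13 1 2 * m13 2 2 * \<Delta> 2 = m13 1 1 * m13 2 1 * \<Delta> 1"
    by (simp add: mult_ac)
  \<comment> \<open>Both equations are this relation: \<open>?E2\<close> arises from
    \<open>?E1\<close> by exchanging the values of the second variable, which negates both
    determinants.\<close>
  from \<Delta> show ?E1
    by (simp add: f \<Delta>_def algebra_simps)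
  from \<Delta> show ?E2
    by (simp add: f \<Delta>_def algebra_simps)
qed

end

theorem proposition17:
  fixes p :: "(nat \<Rightarrow> nat) pmf" and d :: "nat \<Rightarrow> nat"
  assumes "d 1 = 2" "d 2 = 2" "d 3 = 2" "d 4 = 2"
    and "positive_on {1, 2, 3, 4} d p"
  shows "p \<in> P_III G\<^sub>4 d \<longleftrightarrow>
     (marg_indep p {1} {2, 3, 4} \<and> marg_indep p {2} {1, 4})
   \<or> (cond_indep p {2} {4} {1} \<and> cond_indep p {1} {2, 4} {3}
      \<and> joint p 1 1 2 1 * joint p 2 2 2 2 - joint p 1 1 2 2 * joint p 2 2 2 1
          = joint p 1 1 1 1 * joint p 2 2 1 2 - joint p 1 1 1 2 * joint p 2 2 1 1
      \<and> joint p 1 2 2 1 * joint p 2 1 2 2 - joint p 1 2 2 2 * joint p 2 1 2 1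
          = joint p 1 2 1 1 * joint p 2 1 1 2 - joint p 1 2 1 2 * joint p 2 1 1 1)"
  (is "_ \<longleftrightarrow> ?M \<or> (?A \<and> ?B \<and> ?E1 \<and> ?E2)")
proof -
  interpret binary_pmf p d
    using assms by unfold_locales
  \<comment> \<open>Condition (ii) contains the model's two independences, so it remains to show
    that (i) implies them and that they imply (i) or the equations.\<close>
  have "p \<in> P_III G\<^sub>4 d \<longleftrightarrow> ?A \<and> ?B"
    using assms by (simp add: P_III_G4)
  moreover have "?A \<and> ?B" if ?M
    using that cond_indep_if_marg_indep
    unfolding marg_indep_1_234 marg_indep_2_14 cond_indep_2_4_given_1 cond_indep_1_24_given_3
    by blast
  moreover have "?M \<or> (?E1 \<and> ?E2)" if ?A ?B
  proof -
    note A = \<open>?A\<close>[unfolded cond_indep_2_4_given_1, rule_format]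
    note B = \<open>?B\<close>[unfolded cond_indep_1_24_given_3, rule_format]
    show ?thesis
    \<comment> \<open>The determinant of \<open>m13\<close> tells whether 1 and 3 are
      independent.\<close>
    proof (cases "m13 1 1 * m13 2 2 = m13 2 1 * m13 1 2")
      case True
      then show ?thesis
        using marg_indep_if_cond_indep[OF A B True]
        unfolding marg_indep_1_234 marg_indep_2_14 by blast
    next
      case False
      then show ?thesis
        using joint_identity_if_cond_indep[OF A B False] by blast
    qed
  qed
  ultimately show ?thesis
    by blast
qed

end
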